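(* Let $L(K_n)$ be the line graph of the complete graph $K_n$. Then $\mathrm{tp}(L(K_n)) = \mathrm{gp}(L(K_n))$, which equals $n$ if $3 \mid n$ and $n-1$ otherwise. Moreover, for $n \geq 4$, $\mathrm{tp}^-(L(K_n)) = n-1$.
   Context: The line graph $L(G)$ has vertex set $E(G)$, two edges adjacent iff they share an endpoint. A set $S \subseteq V(G)$ is in general position if no shortest path of $G$ contains three vertices of $S$; $\mathrm{gp}(G)$ is the order of a largest general position set. A terminal set of $G$ is a general position set $S$ that is maximal under inclusion and such that for every $u \in V(G)\setminus S$ there is a shortest path of $G$ with $u$ as an endpoint containing at least two vertices of $S$. $\mathrm{tp}(G)$ and $\mathrm{tp}^-(G)$ are the orders of a largest and a smallest terminal set of $G$, respectively. *)

theory Defs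
  imports Main
begin

record 'a ugraph =
  verts :: "'a set"
  edges :: "'a set set"

definition simple_graph :: "'a ugraph \<Rightarrow> bool" where
  "simple_graph G \<longleftrightarrow>
     finite (verts G) \<and> edges G \<subseteq> {e. e \<subseteq> verts G \<and> card e = 2}"

definition complete_graph :: "nat \<Rightarrow> nat ugraph" where
  "complete_graph n = \<lparr>verts = {1..n}, edges = {e. e \<subseteq> {1..n} \<and> card e = 2}\<rparr>"

definition line_graph :: "'a ugraph \<Rightarrow> 'a set ugraph" where
  "line_graph G = \<lparr>verts = edges G,
     edges = {{e, f} | e f. e \<in> edges G \<and> f \<in> edges G \<and> e \<noteq> f \<and> e \<inter> f \<noteq> {}}\<rparr>"

text \<open>A path is given by its nonempty list of pairwise distinct vertices. A single
  vertex is a path of length 0.\<close>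

definition is_path :: "'a ugraph \<Rightarrow> 'a list \<Rightarrow> bool" where
  "is_path G p \<longleftrightarrow>
     p \<noteq> [] \<and> set p \<subseteq> verts G \<and> distinct p \<and> successively (\<lambda>u v. {u, v} \<in> edges G) p"

definition shortest_path :: "'a ugraph \<Rightarrow> 'a list \<Rightarrow> bool" where
  "shortest_path G p \<longleftrightarrow>
     is_path G p \<and>
     (\<forall>q. is_path G q \<and> hd q = hd p \<and> last q = last p \<longrightarrow> length p \<le> length q)"

definition general_position :: "'a ugraph \<Rightarrow> 'a set \<Rightarrow> bool" where
  "general_position G S \<longleftrightarrow>
     S \<subseteq> verts G \<and> \<not> (\<exists>p. shortest_path G p \<and> card (S \<inter> set p) \<ge> 3)"

definition terminal_set :: "'a ugraph \<Rightarrow> 'a set \<Rightarrow> bool" where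
  "terminal_set G S \<longleftrightarrow>
     general_position G S \<and>
     (\<forall>T. general_position G T \<and> S \<subseteq> T \<longrightarrow> T = S) \<and>
     (\<forall>u \<in> verts G - S. \<exists>p. shortest_path G p \<and> (hd p = u \<or> last p = u) \<and>
        card (S \<inter> set p) \<ge> 2)"

text \<open>For finite graphs the sets of orders below are finite. A graph may have no terminal
  set; then \<open>tp\<close> and \<open>tp_min\<close> are the unspecified values \<open>Max {}\<close> and \<open>Min {}\<close>.\<close>

definition gp :: "'a ugraph \<Rightarrow> nat" where
  "gp G = Max {card S | S. general_position G S}"

definition tp :: "'a ugraph \<Rightarrow> nat" where
  "tp G = Max {card S | S. terminal_set G S}"

definition tp_min :: "'a ugraph \<Rightarrow> nat" where
  "tp_min G = Min {card S | S. terminal_set G S}"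

lemma simple_graph_complete_graph: "simple_graph (complete_graph n)"
  by (simp add: simple_graph_def complete_graph_def)

lemma simple_graph_line_graph:
  assumes "simple_graph G" shows "simple_graph (line_graph G)"
proof -
  have "finite (edges G)"
    using assms unfolding simple_graph_def
    by (metis (no_types, lifting) Collect_mono_iff finite_Collect_subsets finite_subset)
  then show ?thesis
    by (auto simp: simple_graph_def line_graph_def card_2_iff)
qed

end

theory Submission
  imports Defs
begin

text \<open>In \<open>L(K\<^sub>n)\<close> the shortest paths with at least three vertices are exactly the triples of
  consecutive edges of a path \<open>P\<^sub>4\<close> in \<open>K\<^sub>n\<close>. Hence a general position set is a
  set of edges without \<open>P\<^sub>4\<close>, that is, a disjoint union of triangles and stars; this
  gives the upper bound. Such a set is terminal iff every missing edge is the end edge of a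
  \<open>P\<^sub>4\<close> whose other two edges are present, which rules out two components that are
  not triangles (join their centres), so at most one edge is lost against \<open>n\<close>.\<close>

section \<open>Edge sets without a path on four vertices\<close>

text \<open>The path need not be induced, and since \<open>distinct\<close> forces
  \<open>a \<noteq> d\<close>, triangles are allowed.\<close>

definition p4_free :: "'a set set \<Rightarrow> bool" where
  "p4_free S \<longleftrightarrow>
     (\<forall>a b c d. distinct [a, b, c, d] \<longrightarrow> {a, b} \<in> S \<longrightarrow> {b, c} \<in> S \<longrightarrow> {c, d} \<notin> S)"

text \<open>A missing pair must be able to serve as an end edge of a P4, not as its middle edge. The
  disjunction reflects that the path may be continued from either endpoint of the unordered
  pair.\<close>

definition p4_end_dominating :: "'a set \<Rightarrow> 'a set set \<Rightarrow> bool" where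
  "p4_end_dominating V S \<longleftrightarrow>
     (\<forall>a\<in>V. \<forall>b\<in>V. a \<noteq> b \<longrightarrow> {a, b} \<notin> S \<longrightarrow>
        (\<exists>c d. distinct [a, b, c, d] \<and> ({a, c} \<in> S \<or> {b, c} \<in> S) \<and> {c, d} \<in> S))"

lemma p4_freeD:
  assumes "p4_free S" "{a, b} \<in> S" "{b, c} \<in> S" "{c, d} \<in> S"
    "a \<noteq> b" "a \<noteq> c" "a \<noteq> d" "b \<noteq> c" "b \<noteq> d" "c \<noteq> d"
  shows False
  using assms unfolding p4_free_def by auto

lemma p4_free_subset: "p4_free S \<Longrightarrow> T \<subseteq> S \<Longrightarrow> p4_free T"
  unfolding p4_free_def by blast

lemma pair_in_edge_set:
  assumes "S \<subseteq> {e. e \<subseteq> V \<and> card e = 2}" "{a, b} \<in> S"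
  shows "a \<in> V" "b \<in> V" "a \<noteq> b"
  using assms by auto

lemma finite_edge_set:
  assumes "finite V" "S \<subseteq> {e. e \<subseteq> V \<and> card e = 2}"
  shows "finite S"
  using assms by (intro finite_subset[of S "Pow V"]) auto

section \<open>Upper bound on the number of edges\<close>

text \<open>An edge entering a triangle from outside, followed by two triangle edges, would be a
  P4.\<close>

lemma triangle_isolated:
  assumes S: "p4_free S" and t: "{a, b} \<in> S" "{b, c} \<in> S" "{a, c} \<in> S" "distinct [a, b, c]"
    and x: "x \<notin> {a, b, c}" "{x, y} \<in> S"
  shows "y \<notin> {a, b, c}"
proof
  have [simp]: "{b, a} \<in> S" "{c, b} \<in> S" "{c, a} \<in> S"
    using t by (simp_all add: insert_commute)
  assume "y \<in> {a, b, c}"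
  then consider "y = a" | "y = b" | "y = c" by blast
  then show False
  proof cases
    case 1
    then show ?thesis using p4_freeD[OF S, of x a b c] t x by auto
  next
    case 2
    then show ?thesis using p4_freeD[OF S, of x b c a] t x by auto
  next
    case 3
    then show ?thesis using p4_freeD[OF S, of x c a b] t x by auto
  qed
qed

text \<open>Induction step for both bounds: no other edge meets the triangle, so removing it costs
  three edges and three vertices. This preserves the difference of the two orders and the residue of
  \<open>card V\<close> modulo 3.\<close>

lemma split_triangle:
  assumes V: "finite V" "S \<subseteq> {e. e \<subseteq> V \<and> card e = 2}" and S: "p4_free S"
    and t: "{a, b} \<in> S" "{b, c} \<in> S" "{a, c} \<in> S" "distinct [a, b, c]"
  shows "card S = card {e \<in> S. e \<subseteq> V - {a, b, c}} + 3"
    and "card V = card (V - {a, b, c}) + 3"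
proof -
  let ?S = "{e \<in> S. e \<subseteq> V - {a, b, c}}" and ?T = "{{a, b}, {b, c}, {a, c}}"
  have fin: "finite S" using finite_edge_set[OF V] .
  have "e \<in> ?S \<union> ?T" if e: "e \<in> S" for e
  proof -
    obtain x y where xy: "e = {x, y}" "x \<noteq> y" "x \<in> V" "y \<in> V"
      using e V by (auto simp: card_2_iff)
    have "x \<notin> {a, b, c} \<longleftrightarrow> y \<notin> {a, b, c}"
      using triangle_isolated[OF S t, of x y] triangle_isolated[OF S t, of y x] e xy
      by (metis insert_commute)
    then show ?thesis using e xy by (auto simp: doubleton_eq_iff)
  qed
  then have "S = ?S \<union> ?T" using t by blast
  moreover have "?S \<inter> ?T = {}" by auto
  moreover have "card ?T = 3" using t(4) by (auto simp: doubleton_eq_iff)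
  ultimately show "card S = card ?S + 3"
    using card_Un_disjoint[of ?S ?T] fin by simp
  have "{a, b, c} \<subseteq> V" using t V by auto
  moreover have "card {a, b, c} = 3" using t(4) by auto
  ultimately show "card V = card (V - {a, b, c}) + 3"
    using V(1) by (metis card_Diff_subset card_mono finite.emptyI finite.insertI le_add_diff_inverse2)
qed

text \<open>Such a set is a forest of stars. The induction deletes a vertex of degree at most one,
  which removes at most one edge.\<close>

lemma card_triangle_free_less:
  assumes "finite V" "V \<noteq> {}" "S \<subseteq> {e. e \<subseteq> V \<and> card e = 2}" "p4_free S"
    and "\<And>a b c. distinct [a, b, c] \<Longrightarrow> {a, b} \<in> S \<Longrightarrow> {b, c} \<in> S \<Longrightarrow> {a, c} \<notin> S"
  shows "card S < card V"
  using assms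
proof (induction "card V" arbitrary: V S rule: less_induct)
  case less
  note V = less.prems(1-3) and S = less.prems(4) and tf = less.prems(5)
  have fin: "finite S" using finite_edge_set less.prems by blast
  have "\<exists>v\<in>V. \<forall>x y. {v, x} \<in> S \<longrightarrow> {v, y} \<in> S \<longrightarrow> x = y"
  proof (rule ccontr)
    assume "\<not> ?thesis"
    then have deg: "\<exists>x y. {v, x} \<in> S \<and> {v, y} \<in> S \<and> x \<noteq> y" if "v \<in> V" for v
      using that by blast
    \<comment> \<open>If all degrees were at least two, a walk \<open>y\<close>, \<open>v\<close>,
      \<open>x\<close>, \<open>z\<close> would exist: it closes to a triangle when
      \<open>z = y\<close> and is a P4 otherwise.\<close>
    obtain v where "v \<in> V" using V by blast
    then obtain x y where xy: "{v, x} \<in> S" "{v, y} \<in> S" "x \<noteq> y" using deg by blast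
    then have "x \<in> V" using V(3) pair_in_edge_set by metis
    then obtain z where z: "{x, z} \<in> S" "z \<noteq> v" using deg by metis
    have ne: "v \<noteq> x" "v \<noteq> y" "x \<noteq> z" using xy z pair_in_edge_set[OF V(3)] by metis+
    show False
    proof (cases "z = y")
      case True
      then show ?thesis using tf[of v x y] xy z ne by auto
    next
      case False
      then show ?thesis
        using p4_freeD[OF S, of z x v y] xy z ne by (auto simp: insert_commute)
    qed
  qed
  then obtain v where v: "v \<in> V" "\<And>x y. {v, x} \<in> S \<Longrightarrow> {v, y} \<in> S \<Longrightarrow> x = y"
    by blast
  let ?S = "{e \<in> S. v \<notin> e}" and ?R = "{e \<in> S. v \<in> e}"
  have R_pair: "\<exists>x. e = {v, x}" if "e \<in> ?R" for e
  proof -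
    have "card e = 2" "v \<in> e" using that V(3) by auto
    then show ?thesis by (auto simp: card_2_iff)
  qed
  have "e = f" if ef: "e \<in> ?R" "f \<in> ?R" for e f
    using R_pair[OF ef(1)] R_pair[OF ef(2)] v(2) ef by blast
  then have R: "card ?R \<le> 1"
    using fin by (simp add: card_le_Suc0_iff_eq)
  have "S = ?S \<union> ?R" by auto
  then have card_S: "card S \<le> card ?S + card ?R" by (metis card_Un_le)
  have sub: "?S \<subseteq> {e. e \<subseteq> V - {v} \<and> card e = 2}" using V by auto
  have card_V: "card V = Suc (card (V - {v}))" using V v by (metis card_Suc_Diff1)
  show ?case
  \<comment> \<open>The strict bound fails for an empty vertex set, so a single vertex is the base
    case.\<close>
  proof (cases "V - {v} = {}")
    case True
    then have "V \<subseteq> {v}" by blast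
    then have "S = {}" using V(3) by (force dest: subset_trans simp: subset_singleton_iff)
    then show ?thesis using card_V by simp
  next
    case False
    have "card ?S < card (V - {v})"
      using less.hyps[OF _ _ False sub] card_V V(1) tf p4_free_subset[OF S, of ?S] by auto
    then show ?thesis using card_S R card_V by linarith
  qed
qed

text \<open>Triangles are split off until none is left; a nonempty remainder then loses at least one
  edge. The remainder can be empty only if 3 divides \<open>card V\<close>.\<close>

lemma card_p4_free_le:
  assumes "finite V" "S \<subseteq> {e. e \<subseteq> V \<and> card e = 2}" "p4_free S"
  shows "card S \<le> (if 3 dvd card V then card V else card V - 1)"
  using assms
proof (induction "card V" arbitrary: V S rule: less_induct)
  case less
  note V = less.prems(1,2) and S = less.prems(3)
  show ?case
  proof (cases "\<exists>a b c. distinct [a, b, c] \<and> {a, b} \<in> S \<and> {b, c} \<in> S \<and> {a, c} \<in> S")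
    case True
    then obtain a b c where t: "{a, b} \<in> S" "{b, c} \<in> S" "{a, c} \<in> S" "distinct [a, b, c]"
      by blast
    let ?V = "V - {a, b, c}" let ?S = "{e \<in> S. e \<subseteq> ?V}"
    note split = split_triangle[OF V S t]
    have "card ?S \<le> (if 3 dvd card ?V then card ?V else card ?V - 1)"
      using V split by (intro less.hyps p4_free_subset[OF S]) auto
    then show ?thesis using split by (cases "card ?V = 0") (auto split: if_splits)
  next
    case False
    show ?thesis
    proof (cases "V = {}")
      case True
      then have "S = {}" using V by auto
      then show ?thesis by simp
    next
      case nonempty: False
      have "card S < card V"
        using card_triangle_free_less[OF V(1) nonempty V(2) S] False by blast
      then show ?thesis by auto
    qed
  qed
qed

section \<open>Lower bound for dominating edge sets\<close>

text \<open>Without triangles every component is a star. Two nonadjacent star centres would violate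
  domination, so a single star covers \<open>V\<close>.\<close>

lemma triangle_free_dominating_spanning_star:
  assumes "V \<noteq> {}" and V: "S \<subseteq> {e. e \<subseteq> V \<and> card e = 2}" and S: "p4_free S"
    and dom: "p4_end_dominating V S"
    and tf: "\<And>a b c. distinct [a, b, c] \<Longrightarrow> {a, b} \<in> S \<Longrightarrow> {b, c} \<in> S \<Longrightarrow> {a, c} \<notin> S"
  obtains c where "c \<in> V" "\<And>v. v \<in> V \<Longrightarrow> v \<noteq> c \<Longrightarrow> {c, v} \<in> S"
proof -
  \<comment> \<open>No walk of length two leads from \<open>v\<close> to another vertex. Isolated
    vertices and both ends of a single-edge component count as centres.\<close>
  define centre where "centre v \<longleftrightarrow> (\<forall>x y. {v, x} \<in> S \<longrightarrow> {x, y} \<in> S \<longrightarrow> y = v)" for v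
  note ne = pair_in_edge_set(3)[OF V]
  \<comment> \<open>If \<open>{v, w}\<close> were missing, domination would give a path of two edges
    leaving one of the two centres.\<close>
  have adj: "{v, w} \<in> S" if "centre v" "centre w" "v \<in> V" "w \<in> V" "v \<noteq> w" for v w
    using that dom unfolding p4_end_dominating_def centre_def by fastforce
  have near: "\<exists>c. centre c \<and> {v, c} \<in> S" if nc: "\<not> centre v" for v
  proof -
    obtain c d where cd: "{v, c} \<in> S" "{c, d} \<in> S" "d \<noteq> v"
      using nc unfolding centre_def by blast
    have "z = c" if yz: "{c, y} \<in> S" "{y, z} \<in> S" for y z
    proof (rule ccontr)
      assume zc: "z \<noteq> c"
      \<comment> \<open>one of \<open>v\<close>, \<open>d\<close> differs from \<open>y\<close> and prolongs the path \<open>c, y, z\<close>\<close>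
      obtain w where w: "w \<noteq> y" "{w, c} \<in> S"
        using cd by (metis insert_commute)
      show False
      proof (cases "z = w")
        case True
        then show ?thesis using tf[of c y w] yz w ne[of c y] ne[of w c] by (auto simp: insert_commute)
      next
        case False
        then show ?thesis
          using p4_freeD[OF S w(2) yz] w zc ne[OF w(2)] ne[OF yz(1)] ne[OF yz(2)] by auto
      qed
    qed
    then show ?thesis using cd unfolding centre_def by blast
  qed
  obtain c where c: "c \<in> V" "centre c"
    using \<open>V \<noteq> {}\<close> near pair_in_edge_set[OF V] by (metis ex_in_conv)
  moreover have "{c, v} \<in> S" if v: "v \<in> V" "v \<noteq> c" for v
  proof (cases "centre v")
    case True
    then show ?thesis using adj c v by blast
  next
    case False
    then obtain c' where c': "centre c'" "{v, c'} \<in> S" using near by blast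
    \<comment> \<open>Otherwise \<open>c\<close>, \<open>c'\<close>, \<open>v\<close> is a walk of
      length two leaving the centre \<open>c\<close>.\<close>
    have "c' = c"
    proof (rule ccontr)
      assume "c' \<noteq> c"
      then have "{c, c'} \<in> S" using adj c c' pair_in_edge_set[OF V c'(2)] by auto
      then show False using c c' v unfolding centre_def by (metis insert_commute)
    qed
    then show ?thesis using c' by (simp add: insert_commute)
  qed
  ultimately show thesis using that by blast
qed

lemma card_star: "finite V \<Longrightarrow> c \<in> V \<Longrightarrow> card ((\<lambda>v. {c, v}) ` (V - {c})) = card V - 1"
  by (subst card_image) (auto simp: inj_on_def doubleton_eq_iff)

text \<open>Splitting off a triangle preserves domination, and what remains in the end is empty or
  has a spanning star. Hence at most one edge is lost in total.\<close>

lemma card_dominating_ge: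
  assumes "finite V" "S \<subseteq> {e. e \<subseteq> V \<and> card e = 2}" "p4_free S" "p4_end_dominating V S"
  shows "card V - 1 \<le> card S"
  using assms
proof (induction "card V" arbitrary: V S rule: less_induct)
  case less
  note V = less.prems(1,2) and S = less.prems(3) and dom = less.prems(4)
  show ?case
  proof (cases "\<exists>a b c. distinct [a, b, c] \<and> {a, b} \<in> S \<and> {b, c} \<in> S \<and> {a, c} \<in> S")
    case True
    then obtain a b c where t: "{a, b} \<in> S" "{b, c} \<in> S" "{a, c} \<in> S" "distinct [a, b, c]"
      by blast
    let ?V = "V - {a, b, c}" let ?S = "{e \<in> S. e \<subseteq> ?V}"
    note split = split_triangle[OF V S t]
    \<comment> \<open>A walk that starts outside the triangle stays outside, so the witnesses for
      domination survive the splitting.\<close>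
    have step: "{x, y} \<in> ?S \<and> y \<in> ?V" if "x \<in> ?V" "{x, y} \<in> S" for x y
      using triangle_isolated[OF S t, of x y] that pair_in_edge_set[OF V(2) that(2)] by auto
    have "p4_end_dominating ?V ?S"
      unfolding p4_end_dominating_def
    proof (intro ballI impI)
      fix x y assume xy: "x \<in> ?V" "y \<in> ?V" "x \<noteq> y" "{x, y} \<notin> ?S"
      then have "{x, y} \<notin> S" by blast
      then obtain z w where zw: "distinct [x, y, z, w]" "{x, z} \<in> S \<or> {y, z} \<in> S" "{z, w} \<in> S"
        using dom xy unfolding p4_end_dominating_def by blast
      have "{x, z} \<in> ?S \<or> {y, z} \<in> ?S" and "z \<in> ?V" using zw xy step by blast+
      moreover have "{z, w} \<in> ?S" using step[OF \<open>z \<in> ?V\<close> zw(3)] by blast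
      ultimately show "\<exists>z w. distinct [x, y, z, w] \<and> ({x, z} \<in> ?S \<or> {y, z} \<in> ?S) \<and> {z, w} \<in> ?S"
        using zw(1) by blast
    qed
    then have "card ?V - 1 \<le> card ?S"
      using V split by (intro less.hyps p4_free_subset[OF S]) auto
    then show ?thesis using split by linarith
  next
    case False
    show ?thesis
    proof (cases "V = {}")
      case True
      then show ?thesis by simp
    next
      case nonempty: False
      obtain c where c: "c \<in> V" "\<And>v. v \<in> V \<Longrightarrow> v \<noteq> c \<Longrightarrow> {c, v} \<in> S"
        using triangle_free_dominating_spanning_star[OF nonempty V(2) S dom] False by blast
      have "card ((\<lambda>v. {c, v}) ` (V - {c})) \<le> card S"
        using c finite_edge_set[OF V] by (intro card_mono) auto
      then show ?thesis using card_star V(1) c(1) by metis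
    qed
  qed
qed

section \<open>Extremal examples: stars and disjoint triangles\<close>

text \<open>The first and last edges of a P4 are disjoint, whereas any two edges of a star meet in
  \<open>c\<close>.\<close>

lemma p4_free_star: "p4_free ((\<lambda>v. {c, v}) ` A)"
  unfolding p4_free_def
proof (intro allI impI notI)
  fix x y z w assume d: "distinct [x, y, z, w]"
    and "{x, y} \<in> (\<lambda>v. {c, v}) ` A" "{z, w} \<in> (\<lambda>v. {c, v}) ` A"
  then have "c \<in> {x, y}" "c \<in> {z, w}" by blast+
  then show False using d by auto
qed

text \<open>A missing pair \<open>a\<close>, \<open>b\<close> is continued through the centre
  \<open>c\<close> to a fourth vertex. For \<open>card V = 3\<close> there is a missing pair but no
  fourth vertex.\<close>

lemma star_dominating:
  assumes "c \<in> V" "card V \<noteq> 3"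
  shows "p4_end_dominating V ((\<lambda>v. {c, v}) ` (V - {c}))"
  unfolding p4_end_dominating_def
proof (intro ballI impI)
  fix a b assume ab: "a \<in> V" "b \<in> V" "a \<noteq> b" "{a, b} \<notin> (\<lambda>v. {c, v}) ` (V - {c})"
  then have ne: "a \<noteq> c" "b \<noteq> c" by (auto simp: doubleton_eq_iff)
  have "V \<noteq> {a, b, c}" using assms(2) ne ab(3) by auto
  then obtain d where "d \<in> V" "d \<notin> {a, b, c}" using ab assms(1) by blast
  then show "\<exists>c' d. distinct [a, b, c', d] \<and>
      ({a, c'} \<in> (\<lambda>v. {c, v}) ` (V - {c}) \<or> {b, c'} \<in> (\<lambda>v. {c, v}) ` (V - {c})) \<and>
      {c', d} \<in> (\<lambda>v. {c, v}) ` (V - {c})"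
    using ab ne by (intro exI[of _ c] exI[of _ d]) (auto simp: insert_commute)
qed

text \<open>The blocks \<open>{3k+1, 3k+2, 3k+3}\<close> are the orbits of this map.\<close>

definition block_succ :: "nat \<Rightarrow> nat" where
  "block_succ v = (if 3 dvd v then v - 2 else v + 1)"

lemma block_succ_simps:
  "block_succ (3 * k + 1) = 3 * k + 2" "block_succ (3 * k + 2) = 3 * k + 3"
  "block_succ (3 * k + 3) = 3 * k + 1"
proof -
  have "\<not> 3 dvd 3 * k + 1" "\<not> 3 dvd 3 * k + 2" by presburger+
  then show "block_succ (3 * k + 1) = 3 * k + 2" "block_succ (3 * k + 2) = 3 * k + 3"
    "block_succ (3 * k + 3) = 3 * k + 1"
    by (simp_all add: block_succ_def)
qed

lemma block_cases:
  fixes v :: nat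
  assumes "v \<ge> 1"
  obtains "v = 3 * ((v - 1) div 3) + 1" | "v = 3 * ((v - 1) div 3) + 2"
    | "v = 3 * ((v - 1) div 3) + 3"
  using assms by linarith

lemma block_succ_props:
  assumes "v \<ge> 1"
  shows "block_succ v \<ge> 1" "block_succ v \<noteq> v" "block_succ (block_succ v) \<noteq> v"
    "(block_succ v - 1) div 3 = (v - 1) div 3"
proof -
  define k where "k = (v - 1) div 3"
  have "block_succ v \<ge> 1 \<and> block_succ v \<noteq> v \<and> block_succ (block_succ v) \<noteq> v \<and>
      (block_succ v - 1) div 3 = k"
    using assms
    by (cases v rule: block_cases; fold k_def) (simp_all only: block_succ_simps, simp_all)
  then show "block_succ v \<ge> 1" "block_succ v \<noteq> v" "block_succ (block_succ v) \<noteq> v"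
    "(block_succ v - 1) div 3 = (v - 1) div 3"
    by (simp_all add: k_def)
qed

text \<open>Divisibility by 3 makes the last block complete, so no block sticks out of
  \<open>{1..n}\<close>.\<close>

lemma block_succ_le:
  assumes "3 dvd n" "v \<le> n"
  shows "block_succ v \<le> n"
proof (cases "v = n")
  case True
  then show ?thesis using assms by (simp add: block_succ_def)
next
  case False
  then show ?thesis using assms by (auto simp: block_succ_def)
qed

text \<open>Any two distinct elements of a 3-cycle are consecutive in one of the two orders; hence
  the edges \<open>{v, block_succ v}\<close> of a block form a full triangle.\<close>

lemma same_block:
  assumes "a \<ge> 1" "b \<ge> 1" "(a - 1) div 3 = (b - 1) div 3"
  shows "a = b \<or> b = block_succ a \<or> a = block_succ b"
proof -
  define k where "k = (a - 1) div 3"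
  have "a = 3 * k + 1 \<or> a = 3 * k + 2 \<or> a = 3 * k + 3"
    using block_cases[OF assms(1)] by (metis k_def)
  moreover have "b = 3 * k + 1 \<or> b = 3 * k + 2 \<or> b = 3 * k + 3"
    using block_cases[OF assms(2)] by (metis k_def assms(3))
  ultimately show ?thesis using block_succ_simps[of k] by presburger
qed

text \<open>The witness is the disjoint union of the triangles on the blocks; indexing its edges by
  \<open>v\<close> gives one edge per vertex.\<close>

lemma ex_triangle_edge_set:
  assumes "3 dvd n"
  shows "\<exists>S\<subseteq>{e. e \<subseteq> {1..n} \<and> card e = 2}. p4_free S \<and> p4_end_dominating {1..n} S \<and> card S = n"
proof -
  let ?s = block_succ
  define S where "S = (\<lambda>v. {v, ?s v}) ` {1..n}"
  have "inj_on (\<lambda>v. {v, ?s v}) {1..n}"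
  proof (rule inj_onI)
    fix v w assume v: "v \<in> {1..n}" and eq: "{v, ?s v} = {w, ?s w}"
    \<comment> \<open>Equal pairs with \<open>v \<noteq> w\<close> would give
      \<open>w = ?s v\<close> and \<open>v = ?s w\<close>, an orbit of length two.\<close>
    have "?s (?s v) \<noteq> v" using block_succ_props(3)[of v] v by simp
    then show "v = w" using eq unfolding doubleton_eq_iff by metis
  qed
  then have card_S: "card S = n" unfolding S_def by (simp add: card_image)
  have "{v, ?s v} \<subseteq> {1..n} \<and> card {v, ?s v} = 2" if "v \<in> {1..n}" for v
    using block_succ_le[OF assms, of v] block_succ_props(1,2)[of v] that by simp
  then have sub: "S \<subseteq> {e. e \<subseteq> {1..n} \<and> card e = 2}" unfolding S_def by blast
  have blk: "a \<ge> 1 \<and> b \<ge> 1 \<and> (a - 1) div 3 = (b - 1) div 3" if "{a, b} \<in> S" for a b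
    using that block_succ_props(1,4) unfolding S_def by (auto simp: doubleton_eq_iff)
  have "p4_free S"
    unfolding p4_free_def
  proof (intro allI impI notI)
    fix a b c d assume "distinct [a, b, c, d]" "{a, b} \<in> S" "{b, c} \<in> S" "{c, d} \<in> S"
    then have d: "distinct [a, b, c, d]" and ge: "a \<ge> 1" "b \<ge> 1" "c \<ge> 1" "d \<ge> 1"
      and eq: "(b - 1) div 3 = (a - 1) div 3" "(c - 1) div 3 = (a - 1) div 3"
        "(d - 1) div 3 = (a - 1) div 3"
      using blk[of a b] blk[of b c] blk[of c d] by auto
    define k where "k = (a - 1) div 3"
    have "v \<in> {3 * k + 1, 3 * k + 2, 3 * k + 3}" if "v \<ge> 1" "(v - 1) div 3 = k" for v
      using block_cases[OF that(1)] that(2) by blast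
    \<comment> \<open>A P4 stays within one block, which has too few elements for four distinct
      vertices.\<close>
    then have "{a, b, c, d} \<subseteq> {3 * k + 1, 3 * k + 2, 3 * k + 3}"
      using ge eq k_def by blast
    then have "card {a, b, c, d} \<le> card {3 * k + 1, 3 * k + 2, 3 * k + 3}"
      by (intro card_mono) auto
    then show False using d by simp
  qed
  moreover have "p4_end_dominating {1..n} S"
    unfolding p4_end_dominating_def
  proof (intro ballI impI)
    fix a b assume ab: "a \<in> {1..n}" "b \<in> {1..n}" "a \<noteq> b" "{a, b} \<notin> S"
    \<comment> \<open>A missing pair joins two blocks; the path continues from \<open>b\<close>
      around the block of \<open>b\<close>.\<close>
    let ?c = "?s b" let ?d = "?s ?c"
    have c: "?c \<in> {1..n}" using ab block_succ_props(1) block_succ_le[OF assms] by auto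
    have "(a - 1) div 3 \<noteq> (b - 1) div 3"
      using same_block[of a b] ab unfolding S_def by (auto simp: insert_commute)
    moreover have "(?c - 1) div 3 = (b - 1) div 3" "(?d - 1) div 3 = (b - 1) div 3"
      using block_succ_props(4) ab c by auto
    ultimately have "a \<noteq> ?c" "a \<noteq> ?d" by metis+
    then have "distinct [a, b, ?c, ?d]"
      using block_succ_props(2,3)[of b] block_succ_props(2)[of ?c] ab c by auto
    moreover have "{b, ?c} \<in> S" "{?c, ?d} \<in> S" using ab c unfolding S_def by blast+
    ultimately show "\<exists>c d. distinct [a, b, c, d] \<and> ({a, c} \<in> S \<or> {b, c} \<in> S) \<and> {c, d} \<in> S"
      by blast
  qed
  ultimately show ?thesis using card_S sub by blast
qed

section \<open>Shortest paths in the line graph\<close>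

lemma verts_line_complete:
  "verts (line_graph (complete_graph n)) = {e. e \<subseteq> {1..n} \<and> card e = 2}"
  by (simp add: line_graph_def complete_graph_def)

lemma edges_line_complete:
  "{e, f} \<in> edges (line_graph (complete_graph n)) \<longleftrightarrow>
     e \<in> verts (line_graph (complete_graph n)) \<and> f \<in> verts (line_graph (complete_graph n)) \<and>
     e \<noteq> f \<and> e \<inter> f \<noteq> {}"
  unfolding line_graph_def by (simp add: doubleton_eq_iff) blast

text \<open>The end edges are disjoint, hence neither equal nor adjacent in the line graph, so no
  path with fewer than three vertices joins them.\<close>

lemma shortest_path_line_complete:
  assumes "distinct [a, b, c, d]" "{a, b, c, d} \<subseteq> {1..n}"
  shows "shortest_path (line_graph (complete_graph n)) [{a, b}, {b, c}, {c, d}]"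
    (is "shortest_path ?G ?p")
proof -
  have "is_path ?G ?p"
    using assms unfolding is_path_def
    by (auto simp: edges_line_complete verts_line_complete doubleton_eq_iff)
  moreover have "3 \<le> length q" if q: "is_path ?G q" "hd q = {a, b}" "last q = {c, d}" for q
  proof (rule ccontr)
    assume "\<not> 3 \<le> length q"
    moreover have "q \<noteq> []" using q by (simp add: is_path_def)
    \<comment> \<open>\<open>remdups_adj.cases\<close> supplies the case split of a list into length
      zero, one and at least two.\<close>
    ultimately consider x where "q = [x]" | x y where "q = [x, y]"
      by (cases q rule: remdups_adj.cases; auto simp: Suc_le_eq; case_tac xs; auto)
    then show False
      using q assms by cases (auto simp: is_path_def edges_line_complete doubleton_eq_iff)
  qed
  ultimately show ?thesis unfolding shortest_path_def by (auto simp: numeral_3_eq_3)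
qed

text \<open>The distance in the line graph is at most two, since disjoint edges have a common
  neighbour. So the path has exactly three vertices, with disjoint ends both met by the middle
  one.\<close>

lemma long_shortest_path_line_complete:
  assumes p: "shortest_path (line_graph (complete_graph n)) p" and len: "length p \<ge> 3"
  obtains a b c d where "p = [{a, b}, {b, c}, {c, d}]" "distinct [a, b, c, d]"
    "{a, b, c, d} \<subseteq> {1..n}"
proof -
  let ?G = "line_graph (complete_graph n)"
  have path: "is_path ?G p" and min: "\<And>q. is_path ?G q \<Longrightarrow> hd q = hd p \<Longrightarrow> last q = last p \<Longrightarrow>
      length p \<le> length q"
    using p unfolding shortest_path_def by blast+
  obtain e f g r where p_eq: "p = e # f # g # r"
    using len by (metis Suc_le_length_iff numeral_3_eq_3)
  let ?l = "last p"
  have l_in: "?l \<in> set (g # r)" using p_eq by (metis last_ConsR last_in_set list.distinct(1))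
  have verts: "e \<in> verts ?G" "f \<in> verts ?G" "?l \<in> verts ?G"
    using path p_eq l_in unfolding is_path_def by (simp, simp, metis last_in_set subsetD)
  have disj: "e \<inter> ?l = {}"
  proof (rule ccontr)
    assume "e \<inter> ?l \<noteq> {}"
    moreover have "e \<noteq> ?l" using path p_eq l_in unfolding is_path_def by force
    ultimately have "is_path ?G [e, ?l]" using verts by (auto simp: is_path_def edges_line_complete)
    from min[OF this] show False using p_eq by auto
  qed
  obtain x y where e: "e = {x, y}" "x \<noteq> y" "x \<in> {1..n}" "y \<in> {1..n}"
    using verts(1) by (auto simp: verts_line_complete card_2_iff)
  obtain z w where l: "?l = {z, w}" "z \<noteq> w" "z \<in> {1..n}" "w \<in> {1..n}"
    using verts(3) by (auto simp: verts_line_complete card_2_iff)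
  \<comment> \<open>This path has the same ends as \<open>p\<close> and bounds its length, but its
    middle edge may differ; the final labels are read off the middle edge \<open>f\<close> of
    \<open>p\<close>.\<close>
  have "shortest_path ?G [{x, y}, {y, z}, {z, w}]"
    using disj e l by (intro shortest_path_line_complete) auto
  then have q: "is_path ?G [{x, y}, {y, z}, {z, w}]" by (simp only: shortest_path_def)
  have "hd p = {x, y}" using p_eq e(1) by simp
  then have "length p \<le> 3" using min[OF q] l(1) by simp
  then have r: "r = []" "?l = g" using p_eq by simp_all
  have "f \<inter> e \<noteq> {}" "f \<inter> g \<noteq> {}"
    using path p_eq r by (auto simp: is_path_def edges_line_complete)
  then obtain b c where bc: "b \<in> f" "b \<in> e" "c \<in> f" "c \<in> g" by blast
  have "b \<noteq> c" using disj bc r by auto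
  then have f: "f = {b, c}"
    using bc verts(2) by (auto simp: verts_line_complete card_2_iff)
  obtain a where a: "e = {a, b}" "a \<noteq> b" using e bc by auto
  obtain d where d: "g = {c, d}" "c \<noteq> d" using l r bc by auto
  show thesis
  proof (rule that)
    show "p = [{a, b}, {b, c}, {c, d}]" using p_eq r(1) f a(1) d(1) by simp
    show "distinct [a, b, c, d]" using disj a d \<open>b \<noteq> c\<close> unfolding r(2) by auto
    have "e \<subseteq> {1..n}" "g \<subseteq> {1..n}"
      using verts(1,3) unfolding r(2) verts_line_complete by blast+
    then show "{a, b, c, d} \<subseteq> {1..n}" using a(1) d(1) by blast
  qed
qed

section \<open>General position and terminal sets as edge sets\<close>

text \<open>A shortest path has at most three vertices, so one containing three members of
  \<open>S\<close> lies entirely in \<open>S\<close> and is a P4.\<close>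

lemma general_position_line_complete:
  "general_position (line_graph (complete_graph n)) S \<longleftrightarrow>
     S \<subseteq> {e. e \<subseteq> {1..n} \<and> card e = 2} \<and> p4_free S"
  (is "general_position ?G S \<longleftrightarrow> ?E \<and> _")
proof (intro iffI conjI)
  assume gp: "general_position ?G S"
  then show E: ?E by (simp add: general_position_def verts_line_complete)
  show "p4_free S"
    unfolding p4_free_def
  proof (intro allI impI notI)
    fix a b c d assume d: "distinct [a, b, c, d]" and e: "{a, b} \<in> S" "{b, c} \<in> S" "{c, d} \<in> S"
    have "S \<inter> set [{a, b}, {b, c}, {c, d}] = {{a, b}, {b, c}, {c, d}}" using e by auto
    moreover have "card {{a, b}, {b, c}, {c, d}} = 3" using d by (auto simp: doubleton_eq_iff)
    moreover have "shortest_path ?G [{a, b}, {b, c}, {c, d}]"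
      using E e d by (intro shortest_path_line_complete) auto
    ultimately show False using gp unfolding general_position_def by (metis order_refl)
  qed
next
  assume S: "?E \<and> p4_free S"
  have False if p: "shortest_path ?G p" and c: "3 \<le> card (S \<inter> set p)" for p
  proof -
    have le: "card (S \<inter> set p) \<le> card (set p)" "card (set p) \<le> length p"
      by (auto intro: card_mono card_length)
    then obtain a b c d where p_eq: "p = [{a, b}, {b, c}, {c, d}]" and d: "distinct [a, b, c, d]"
      using long_shortest_path_line_complete[OF p] c by (metis le_trans)
    then have "S \<inter> set p = set p"
      using c le by (intro card_subset_eq) auto
    then have "set p \<subseteq> S" by blast
    then show False using S p_eq d unfolding p4_free_def by auto
  qed
  then show "general_position ?G S"
    using S unfolding general_position_def by (auto simp: verts_line_complete)
qed

text \<open>Two members of \<open>S\<close> together with the missing \<open>{a, b}\<close> fill a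
  shortest path of three vertices, which is a P4 ending in \<open>{a, b}\<close>.\<close>

lemma end_of_shortest_path_line_complete:
  assumes "a \<in> {1..n}" "b \<in> {1..n}" "a \<noteq> b" "{a, b} \<notin> S" "S \<subseteq> {e. e \<subseteq> {1..n} \<and> card e = 2}"
  shows "(\<exists>p. shortest_path (line_graph (complete_graph n)) p \<and> (hd p = {a, b} \<or> last p = {a, b}) \<and>
            card (S \<inter> set p) \<ge> 2) \<longleftrightarrow>
         (\<exists>c d. distinct [a, b, c, d] \<and> ({a, c} \<in> S \<or> {b, c} \<in> S) \<and> {c, d} \<in> S)"
    (is "?L \<longleftrightarrow> ?R")
proof
  assume ?L
  then obtain p where p: "shortest_path (line_graph (complete_graph n)) p"
    and ends: "hd p = {a, b} \<or> last p = {a, b}" and c2: "card (S \<inter> set p) \<ge> 2" by blast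
  have "p \<noteq> []" using p by (simp add: shortest_path_def is_path_def)
  then have in_p: "{a, b} \<in> set p" using ends by (metis hd_in_set last_in_set)
  have "card (insert {a, b} (S \<inter> set p)) \<le> card (set p)"
    using in_p by (intro card_mono) auto
  then have "3 \<le> length p" using c2 assms(4) card_length[of p] by simp
  then obtain x y z w where p_eq: "p = [{x, y}, {y, z}, {z, w}]" and d: "distinct [x, y, z, w]"
    using long_shortest_path_line_complete[OF p] by metis
  \<comment> \<open>Both sides have order two: \<open>p\<close> has at most three vertices, and one
    of them is \<open>{a, b}\<close>, outside \<open>S\<close>.\<close>
  have "S \<inter> set p = set p - {{a, b}}"
  proof (rule card_subset_eq)
    have "card (set p) \<le> 3" using p_eq card_length[of p] by simp
    then have "card (set p - {{a, b}}) \<le> 2" using in_p by simp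
    moreover have "card (S \<inter> set p) \<le> card (set p - {{a, b}})"
      using assms(4) by (intro card_mono) auto
    ultimately show "card (S \<inter> set p) = card (set p - {{a, b}})" using c2 by linarith
  qed (use assms(4) in auto)
  then have sub: "set p - {{a, b}} \<subseteq> S" by blast
  from ends show ?R
  proof
    assume "hd p = {a, b}"
    then have ab: "{x, y} = {a, b}" using p_eq by simp
    then have "{y, z} \<in> S" "{z, w} \<in> S" using sub p_eq d by (auto simp: doubleton_eq_iff)
    then show ?R using ab d by (intro exI[of _ z] exI[of _ w]) (auto simp: doubleton_eq_iff)
  next
    assume "last p = {a, b}"
    then have ab: "{z, w} = {a, b}" using p_eq by simp
    then have "{x, y} \<in> S" "{y, z} \<in> S" using sub p_eq d by (auto simp: doubleton_eq_iff)
    then show ?R using ab d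
      by (intro exI[of _ y] exI[of _ x]) (auto simp: doubleton_eq_iff insert_commute)
  qed
next
  \<comment> \<open>Stated for \<open>x\<close>, \<open>y\<close> so that it applies to both
    orientations of \<open>{a, b}\<close>.\<close>
  have main: ?L if "{x, y} = {a, b}" "distinct [x, y, c, d]" "{y, c} \<in> S" "{c, d} \<in> S" for x y c d
  proof (intro exI conjI)
    let ?p = "[{x, y}, {y, c}, {c, d}]"
    show "shortest_path (line_graph (complete_graph n)) ?p"
    proof (rule shortest_path_line_complete[OF that(2)])
      have "{x, y} \<subseteq> {1..n}" using assms(1,2) unfolding that(1) by simp
      then show "{x, y, c, d} \<subseteq> {1..n}" using pair_in_edge_set[OF assms(5) that(4)] by blast
    qed
    show "hd ?p = {a, b} \<or> last ?p = {a, b}" using that(1) by simp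
    have "S \<inter> set ?p = {{y, c}, {c, d}}" using that(3,4) assms(4) unfolding that(1) by auto
    moreover have "{y, c} \<noteq> {c, d}" using that(2) by (auto simp: doubleton_eq_iff)
    ultimately show "2 \<le> card (S \<inter> set ?p)" by simp
  qed
  assume ?R
  then obtain c d where cd: "distinct [a, b, c, d]" "{a, c} \<in> S \<or> {b, c} \<in> S" "{c, d} \<in> S"
    by blast
  from cd(2) show ?L
  proof
    assume "{a, c} \<in> S"
    then show ?L by (intro main[of b a c d]) (use cd in auto)
  next
    assume "{b, c} \<in> S"
    then show ?L by (intro main[of a b c d]) (use cd in auto)
  qed
qed

text \<open>Maximality under inclusion is implied by the condition on shortest paths: a vertex added
  to \<open>S\<close> would be the third one on such a path.\<close>

lemma terminal_set_line_complete:
  "terminal_set (line_graph (complete_graph n)) S \<longleftrightarrow>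
     S \<subseteq> {e. e \<subseteq> {1..n} \<and> card e = 2} \<and> p4_free S \<and> p4_end_dominating {1..n} S"
  (is "terminal_set ?G S \<longleftrightarrow> ?R")
proof
  assume t: "terminal_set ?G S"
  then have S: "S \<subseteq> {e. e \<subseteq> {1..n} \<and> card e = 2}" "p4_free S"
    by (auto simp: terminal_set_def general_position_line_complete)
  have "p4_end_dominating {1..n} S"
    unfolding p4_end_dominating_def
  proof (intro ballI impI)
    fix a b assume ab: "a \<in> {1..n}" "b \<in> {1..n}" "a \<noteq> b" "{a, b} \<notin> S"
    then have "{a, b} \<in> verts ?G - S" by (simp add: verts_line_complete)
    then show "\<exists>c d. distinct [a, b, c, d] \<and> ({a, c} \<in> S \<or> {b, c} \<in> S) \<and> {c, d} \<in> S"
      using t end_of_shortest_path_line_complete[OF ab S(1)] unfolding terminal_set_def by blast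
  qed
  then show ?R using S by blast
next
  assume R: ?R
  have ends: "\<exists>p. shortest_path ?G p \<and> (hd p = u \<or> last p = u) \<and> card (S \<inter> set p) \<ge> 2"
    if u: "u \<in> verts ?G - S" for u
  proof -
    obtain a b where ab: "u = {a, b}" "a \<noteq> b" "a \<in> {1..n}" "b \<in> {1..n}" "{a, b} \<notin> S"
      using u by (auto simp: verts_line_complete card_2_iff)
    then show ?thesis
      using end_of_shortest_path_line_complete[of a n b S] R unfolding p4_end_dominating_def by blast
  qed
  have "T = S" if T: "general_position ?G T" "S \<subseteq> T" for T
  proof (rule ccontr)
    assume "T \<noteq> S"
    then obtain u where u: "u \<in> T" "u \<in> verts ?G - S"
      using T unfolding general_position_def by blast
    then obtain p where p: "shortest_path ?G p" "hd p = u \<or> last p = u" "card (S \<inter> set p) \<ge> 2"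
      using ends by blast
    have "p \<noteq> []" using p by (simp add: shortest_path_def is_path_def)
    then have "u \<in> set p" using p by auto
    then have "card (insert u (S \<inter> set p)) \<le> card (T \<inter> set p)"
      using u T by (intro card_mono) auto
    then have "3 \<le> card (T \<inter> set p)" using u p by simp
    then show False using T p unfolding general_position_def by blast
  qed
  then show "terminal_set ?G S"
    using R ends unfolding terminal_set_def by (simp add: general_position_line_complete)
qed

section \<open>The values of the three invariants\<close>

lemma terminal_star:
  assumes "n \<noteq> 3"
  shows "\<exists>S. terminal_set (line_graph (complete_graph n)) S \<and> card S = n - 1"
proof (cases "n = 0")
  case True
  \<comment> \<open>There is no centre 1 here; the empty set works because \<open>n - 1\<close> is
    truncated to 0.\<close>
  then show ?thesis
    by (intro exI[of _ "{}"])
      (simp add: terminal_set_line_complete p4_free_def p4_end_dominating_def)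
next
  case False
  let ?S = "(\<lambda>v. {1, v}) ` ({1..n} - {1})"
  have "terminal_set (line_graph (complete_graph n)) ?S"
    unfolding terminal_set_line_complete
  proof (intro conjI p4_free_star star_dominating)
    show "?S \<subseteq> {e. e \<subseteq> {1..n} \<and> card e = 2}" by auto
  qed (use False assms in auto)
  moreover have "card ?S = n - 1" using card_star[of "{1..n}" 1] False by simp
  ultimately show ?thesis by blast
qed

theorem theorem4p3:
  fixes n :: nat
  shows "tp (line_graph (complete_graph n)) = gp (line_graph (complete_graph n)) \<and>
    gp (line_graph (complete_graph n)) = (if 3 dvd n then n else n - 1) \<and>
    (n \<ge> 4 \<longrightarrow> tp_min (line_graph (complete_graph n)) = n - 1)"
proof -
  let ?G = "line_graph (complete_graph n)" and ?m = "if 3 dvd n then n else n - 1"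
  have gp_le: "card S \<le> ?m" if "general_position ?G S" for S
    using card_p4_free_le[of "{1..n}" S] that by (auto simp: general_position_line_complete)
  have term_gp: "general_position ?G S" if "terminal_set ?G S" for S
    using that by (simp add: terminal_set_def)
  have term_ge: "n - 1 \<le> card S" if "terminal_set ?G S" for S
    using card_dominating_ge[of "{1..n}" S] that by (auto simp: terminal_set_line_complete)
  have fin_gp: "finite {card S |S. general_position ?G S}"
    by (rule finite_subset[of _ "{..?m}"]) (use gp_le in auto)
  have fin_tp: "finite {card S |S. terminal_set ?G S}"
    by (rule finite_subset[OF _ fin_gp]) (use term_gp in auto)
  \<comment> \<open>One terminal set attaining the upper bound settles both \<open>gp\<close> and
    \<open>tp\<close>: disjoint triangles if 3 divides \<open>n\<close>, a star otherwise.\<close>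
  obtain S where S: "terminal_set ?G S" "card S = ?m"
  proof (cases "3 dvd n")
    case True
    then show thesis
      using ex_triangle_edge_set[OF True] that by (auto simp: terminal_set_line_complete)
  next
    case False
    then have "n \<noteq> 3" by auto
    then show thesis using terminal_star[of n] that False by auto
  qed
  have "gp ?G = ?m"
    unfolding gp_def
  proof (rule Max_eqI[OF fin_gp])
    show "k \<le> ?m" if "k \<in> {card S |S. general_position ?G S}" for k
      using that gp_le by blast
    show "?m \<in> {card S |S. general_position ?G S}"
      using term_gp[OF S(1)] S(2)[symmetric] by blast
  qed
  moreover have "tp ?G = ?m"
    unfolding tp_def
  proof (rule Max_eqI[OF fin_tp])
    show "k \<le> ?m" if "k \<in> {card S |S. terminal_set ?G S}" for k
      using that gp_le term_gp by blast
    show "?m \<in> {card S |S. terminal_set ?G S}"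
      using S(1) S(2)[symmetric] by blast
  qed
  moreover have "tp_min ?G = n - 1" if "n \<ge> 4"
    unfolding tp_min_def
  proof (rule Min_eqI[OF fin_tp])
    \<comment> \<open>A star attains the lower bound \<open>term_ge\<close>;
      \<open>n \<ge> 4\<close> excludes the exceptional case \<open>n = 3\<close>.\<close>
    obtain S where "terminal_set ?G S" "card S = n - 1" using terminal_star[of n] \<open>n \<ge> 4\<close> by auto
    then show "n - 1 \<in> {card S |S. terminal_set ?G S}" by force
  qed (use term_ge in auto)
  ultimately show ?thesis by simp
qed

end
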